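(* Let $\widehat{\alpha}$ and $\widehat{\beta}$ be two curves in $\mathbb{D}^3$. If $\widehat{\alpha}$ and $\widehat{\beta}$ are Bertrand curves, then $$d\big(\widehat{\alpha}(s),\widehat{\beta}(s)\big)=\widehat{c},$$ where $s\in I\subset\mathbb{D}$ and $\widehat{c}\in\mathbb{D}$ is constant; that is, the distance between the corresponding points of the two curves is constant.
   Context: Dual numbers: $\mathbb{D}=\{\widehat a=a+\varepsilon a^*: a,a^*\in\mathbb{R}\}$ with $\varepsilon^2=0$, a commutative ring under $(a+\varepsilon a^* )+(b+\varepsilon b^* )=(a+b)+\varepsilon(a^*+b^* )$ and $(a+\varepsilon a^* )(b+\varepsilon b^* )=ab+\varepsilon(ab^*+ba^* )$. A dual number is pure-dual if its real part $a$ is $0$. $\mathbb{D}^3$ is the $\mathbb{D}$-module of dual vectors $\widehat a=a+\varepsilon a^*$ with $a,a^*\in\mathbb{R}^3$. Inner product: $\langle\widehat a,\widehat b\rangle=\langle a,b\rangle+\varepsilon(\langle a,b^*\rangle+\langle a^*,b\rangle)$. The cross product is given by the usual coordinate formula with dual entries. Norm: $\|\widehat a\|=\sqrt{\langle\widehat a,\widehat a\rangle}=\|a\|+\varepsilon\frac{\langle a,a^*\rangle}{\|a\|}$ for $a\neq0$. Distance: $d(\widehat a,\widehat b)=\|\widehat b-\widehat a\|$. A dual space curve is a map $\widehat\alpha:I\subset\mathbb{D}\to\mathbb{D}^3$, $\widehat\alpha(s)=\alpha(s)+\varepsilon\alpha^*(s)$, with $\alpha,\alpha^*$ differentiable vector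 functions. With respect to its dual arc-length parameter, its Frenet frame $\{\widehat T,\widehat N,\widehat B\}$ (unit tangent, unit principal normal, binormal $\widehat B=\widehat T\times\widehat N$), curvature $\widehat\kappa$ and torsion $\widehat\tau$ (both $\mathbb{D}$-valued and nowhere pure-dual) satisfy $\widehat T=\widehat\alpha'$, $\widehat T'=\widehat\kappa\widehat N$, $\widehat N'=-\widehat\kappa\widehat T+\widehat\tau\widehat B$, $\widehat B'=-\widehat\tau\widehat N$. Bertrand curves: dual space curves $\widehat\alpha$ and $\widehat\beta$ are called Bertrand curves in $\mathbb{D}^3$ if there exists a correspondence between $\widehat\alpha$ and $\widehat\beta$ such that the principal normal vectors of $\widehat\alpha$ and $\widehat\beta$ are linearly dependent at the corresponding points of the curves. Here $s$ is the arc-length parameter of $\widehat\alpha$, and $\widehat\beta(s)$ denotes the point of $\widehat\beta$ corresponding to $\widehat\alpha(s)$.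
   Formalization: Bertrand curves are taken to share the principal normal line at corresponding points (for parallel normals alone a helix and its double are a counterexample); the correspondence is differentiable and the dependence has coefficients not both pure-dual. *)

theory Defs
  imports "HOL-Analysis.Analysis"
begin

section \<open>Dual numbers\<close>

text \<open>\<open>Dual a b\<close> is the dual number \<open>a + \<epsilon> b\<close> with \<open>\<epsilon>\<^sup>2 = 0\<close>.\<close>

datatype dual_number = Dual (re_part: real) (du_part: real)

lemma dual_number_eq_iff: "x = y \<longleftrightarrow> re_part x = re_part y \<and> du_part x = du_part y"
  by (cases x; cases y) simp

instantiation dual_number :: comm_ring_1
begin

definition "0 = Dual 0 0"

definition "1 = Dual 1 0"

definition "x + y = Dual (re_part x + re_part y) (du_part x + du_part y)"

definition "x - y = Dual (re_part x - re_part y) (du_part x - du_part y)"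

definition "- x = Dual (- re_part x) (- du_part x)"

definition "x * y = Dual (re_part x * re_part y) (re_part x * du_part y + du_part x * re_part y)"

instance
  by standard (simp_all add: zero_dual_number_def one_dual_number_def plus_dual_number_def
      minus_dual_number_def uminus_dual_number_def times_dual_number_def algebra_simps)

end

lemma dual_number_parts [simp]:
  "re_part 0 = 0" "du_part 0 = 0"
  "re_part 1 = 1" "du_part 1 = 0"
  "re_part (x + y) = re_part x + re_part y" "du_part (x + y) = du_part x + du_part y"
  "re_part (x - y) = re_part x - re_part y" "du_part (x - y) = du_part x - du_part y"
  "re_part (- x) = - re_part x" "du_part (- x) = - du_part x"
  "re_part (x * y) = re_part x * re_part y"
  "du_part (x * y) = re_part x * du_part y + du_part x * re_part y"
  by (simp_all add: zero_dual_number_def one_dual_number_def plus_dual_number_def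
      minus_dual_number_def uminus_dual_number_def times_dual_number_def)

instantiation dual_number :: scaleR
begin

definition "r *\<^sub>R x = Dual (r * re_part x) (r * du_part x)"

instance ..

end

text \<open>
  The class \<^class>\<open>real_normed_algebra_1\<close> supplies the topology of the real plane and with it
  \<^const>\<open>has_derivative\<close>. The real-valued \<^const>\<open>norm\<close> serves this purpose only; of the equivalent
  norms on the plane, the sum norm is chosen because it is submultiplicative. It is unrelated to the
  dual-valued norm of dual vectors (\<open>dual_norm\<close> below).
\<close>

instantiation dual_number :: real_normed_algebra_1
begin

definition norm_dual_number_def: "norm x = \<bar>re_part x\<bar> + \<bar>du_part x\<bar>"

definition sgn_dual_number_def: "sgn (x :: dual_number) = x /\<^sub>R norm x"

definition dist_dual_number_def: "dist (x :: dual_number) y = norm (x - y)"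

definition uniformity_dual_number_def [code del]:
  "(uniformity :: (dual_number \<times> dual_number) filter) =
    (INF e\<in>{0 <..}. principal {(x, y). dist x y < e})"

definition open_dual_number_def [code del]:
  "open (U :: dual_number set) \<longleftrightarrow>
    (\<forall>x\<in>U. eventually (\<lambda>(x', y). x' = x \<longrightarrow> y \<in> U) uniformity)"

instance
proof
  fix a b :: real and x y :: dual_number
  show "a *\<^sub>R (x + y) = a *\<^sub>R x + a *\<^sub>R y" "(a + b) *\<^sub>R x = a *\<^sub>R x + b *\<^sub>R x"
    "a *\<^sub>R b *\<^sub>R x = (a * b) *\<^sub>R x" "1 *\<^sub>R x = x"
    "a *\<^sub>R x * y = a *\<^sub>R (x * y)" "x * a *\<^sub>R y = a *\<^sub>R (x * y)"
    by (simp_all add: dual_number_eq_iff scaleR_dual_number_def algebra_simps)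
  show "(norm x = 0) = (x = 0)"
    by (auto simp: norm_dual_number_def dual_number_eq_iff)
  show "norm (x + y) \<le> norm x + norm y"
    by (simp add: norm_dual_number_def)
  show "norm (a *\<^sub>R x) = \<bar>a\<bar> * norm x"
    by (simp add: norm_dual_number_def scaleR_dual_number_def abs_mult algebra_simps)
  show "norm (x * y) \<le> norm x * norm y"
  proof -
    have "\<bar>re_part x * du_part y + du_part x * re_part y\<bar>
        \<le> \<bar>re_part x\<bar> * \<bar>du_part y\<bar> + \<bar>du_part x\<bar> * \<bar>re_part y\<bar>"
      by (metis abs_mult abs_triangle_ineq)
    also have "\<dots> \<le> \<bar>re_part x\<bar> * \<bar>du_part y\<bar> + \<bar>du_part x\<bar> * \<bar>re_part y\<bar> + \<bar>du_part x\<bar> * \<bar>du_part y\<bar>"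
      by simp
    finally show ?thesis
      by (simp add: norm_dual_number_def abs_mult algebra_simps)
  qed
  show "norm (1 :: dual_number) = 1"
    by (simp add: norm_dual_number_def)
qed (rule sgn_dual_number_def dist_dual_number_def open_dual_number_def
      uniformity_dual_number_def)+

end

definition pure_dual :: "dual_number \<Rightarrow> bool"
  where "pure_dual x \<longleftrightarrow> re_part x = 0"

text \<open>
  The square root is the dual extension \<open>f (a + \<epsilon> b) = f a + \<epsilon> b f' a\<close> of \<^const>\<open>sqrt\<close>. It is meant for
  a positive real part; by the convention for division by zero, \<open>dual_sqrt 0 = 0\<close>.
\<close>

definition dual_sqrt :: "dual_number \<Rightarrow> dual_number"
  where "dual_sqrt x = Dual (sqrt (re_part x)) (du_part x / (2 * sqrt (re_part x)))"

section \<open>Dual vectors\<close>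

type_synonym dual_vector = "dual_number ^ 3"

definition re_vec :: "dual_vector \<Rightarrow> real ^ 3"
  where "re_vec v = (\<chi> i. re_part (v $ i))"

definition du_vec :: "dual_vector \<Rightarrow> real ^ 3"
  where "du_vec v = (\<chi> i. du_part (v $ i))"

definition dual_inner :: "dual_vector \<Rightarrow> dual_vector \<Rightarrow> dual_number"
  where "dual_inner v w =
    Dual (re_vec v \<bullet> re_vec w) (re_vec v \<bullet> du_vec w + du_vec v \<bullet> re_vec w)"

definition dual_cross :: "dual_vector \<Rightarrow> dual_vector \<Rightarrow> dual_vector"
  where "dual_cross v w =
    vector [v $ 2 * w $ 3 - v $ 3 * w $ 2,
            v $ 3 * w $ 1 - v $ 1 * w $ 3,
            v $ 1 * w $ 2 - v $ 2 * w $ 1]"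

definition dual_norm :: "dual_vector \<Rightarrow> dual_number"
  where "dual_norm v = dual_sqrt (dual_inner v v)"

lemma dual_norm_eq: "dual_norm v = Dual (norm (re_vec v)) (re_vec v \<bullet> du_vec v / norm (re_vec v))"
  by (simp add: dual_norm_def dual_sqrt_def dual_inner_def norm_eq_sqrt_inner inner_commute)

definition dual_dist :: "dual_vector \<Rightarrow> dual_vector \<Rightarrow> dual_number"
  where "dual_dist v w = dual_norm (w - v)"

text \<open>
  Coefficients that are both zero divisors are excluded: \<open>\<epsilon> v + \<epsilon> w = 0\<close> would only relate the real
  parts of \<open>v\<close> and \<open>w\<close>.
\<close>

definition dual_linearly_dependent :: "dual_vector \<Rightarrow> dual_vector \<Rightarrow> bool"
  where "dual_linearly_dependent v w \<longleftrightarrow>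
    (\<exists>a b. \<not> (pure_dual a \<and> pure_dual b) \<and> a *s v + b *s w = 0)"

section \<open>Dual space curves\<close>

text \<open>
  A parameter domain is a set of dual numbers in which any two points are joined by a piecewise
  \<open>C\<^sup>1\<close> path. This covers real intervals, open connected sets and strips \<open>{s. re_part s \<in> A}\<close> over a
  real interval \<open>A\<close>, as well as the range of a dual arc-length function of a real parameter. Mere
  connectedness would not be enough for a vanishing derivative to force constancy.
\<close>

definition dual_interval :: "dual_number set \<Rightarrow> bool"
  where "dual_interval I \<longleftrightarrow>
    (\<forall>x\<in>I. \<forall>y\<in>I. \<exists>\<gamma>. valid_path \<gamma> \<and> path_image \<gamma> \<subseteq> I \<and> pathstart \<gamma> = x \<and> pathfinish \<gamma> = y)"

text \<open>
  Derivatives with respect to a dual variable are Frechet derivatives that are linear over the dual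
  numbers.
\<close>

definition has_dual_derivative ::
    "(dual_number \<Rightarrow> dual_number) \<Rightarrow> dual_number \<Rightarrow> dual_number \<Rightarrow> dual_number set \<Rightarrow> bool"
  where "has_dual_derivative f d s I \<longleftrightarrow> (f has_derivative (\<lambda>h. h * d)) (at s within I)"

definition has_dual_vector_derivative ::
    "(dual_number \<Rightarrow> dual_vector) \<Rightarrow> dual_vector \<Rightarrow> dual_number \<Rightarrow> dual_number set \<Rightarrow> bool"
  where "has_dual_vector_derivative f v s I \<longleftrightarrow> (f has_derivative (\<lambda>h. h *s v)) (at s within I)"

text \<open>The parameter of \<open>\<alpha>\<close> is arc length, since the tangent \<open>T\<close> is both its derivative and a unit vector.\<close>

definition dual_frenet_curve ::
    "dual_number set \<Rightarrow> (dual_number \<Rightarrow> dual_vector) \<Rightarrow> (dual_number \<Rightarrow> dual_vector) \<Rightarrow>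
     (dual_number \<Rightarrow> dual_vector) \<Rightarrow> (dual_number \<Rightarrow> dual_vector) \<Rightarrow>
     (dual_number \<Rightarrow> dual_number) \<Rightarrow> (dual_number \<Rightarrow> dual_number) \<Rightarrow> bool"
  where "dual_frenet_curve I \<alpha> T N B \<kappa> \<tau> \<longleftrightarrow>
    dual_interval I \<and>
    (\<forall>s\<in>I.
      dual_inner (T s) (T s) = 1 \<and> dual_inner (N s) (N s) = 1 \<and> dual_inner (T s) (N s) = 0 \<and>
      B s = dual_cross (T s) (N s) \<and>
      \<not> pure_dual (\<kappa> s) \<and> \<not> pure_dual (\<tau> s) \<and>
      has_dual_vector_derivative \<alpha> (T s) s I \<and>
      has_dual_vector_derivative T (\<kappa> s *s N s) s I \<and>
      has_dual_vector_derivative N (- (\<kappa> s *s T s) + \<tau> s *s B s) s I \<and>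
      has_dual_vector_derivative B (- (\<tau> s *s N s)) s I)"

text \<open>
  The curves \<open>\<alpha>\<close> on \<open>I\<close> and \<open>\<beta>\<close> on \<open>J\<close>, with principal normals \<open>N\<close> and \<open>M\<close>, correspond through the
  change of parameter \<open>\<phi>\<close>, so that \<open>\<beta> (\<phi> s)\<close> is the point corresponding to \<open>\<alpha> s\<close>. Linear dependence
  of the principal normals is understood for vectors attached to their points: corresponding points
  have the same principal normal line. For free vectors, a curve and any of its homothetic images
  would form a Bertrand pair.
\<close>

definition bertrand_correspondence ::
    "dual_number set \<Rightarrow> (dual_number \<Rightarrow> dual_vector) \<Rightarrow> (dual_number \<Rightarrow> dual_vector) \<Rightarrow>
     dual_number set \<Rightarrow> (dual_number \<Rightarrow> dual_vector) \<Rightarrow> (dual_number \<Rightarrow> dual_vector) \<Rightarrow>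
     (dual_number \<Rightarrow> dual_number) \<Rightarrow> bool"
  where "bertrand_correspondence I \<alpha> N J \<beta> M \<phi> \<longleftrightarrow>
    \<phi> ` I = J \<and>
    (\<forall>s\<in>I.
      (\<exists>d. has_dual_derivative \<phi> d s I) \<and>
      dual_linearly_dependent (N s) (M (\<phi> s)) \<and>
      (\<exists>l. \<beta> (\<phi> s) = \<alpha> s + l *s N s))"

end

theory Submission
  imports Defs
begin

text \<open>
  Corresponding points lie on a common principal normal line, so \<open>\<beta> (\<phi> s) - \<alpha> s = l s *s N s\<close>, where
  \<open>N\<close> is the principal normal of \<open>\<alpha>\<close> and \<open>l s = \<langle>\<beta> (\<phi> s) - \<alpha> s, N s\<rangle>\<close>. Differentiating this inner product
  in direction \<open>h\<close> gives
  \<open>h * (\<phi>' * \<langle>T\<^sub>\<beta>, N\<rangle> - \<langle>T\<^sub>\<alpha>, N\<rangle> + l s * \<langle>N, N'\<rangle>)\<close>.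
  All three terms vanish: the first because \<open>N\<close> is, up to a unit of the dual numbers, the principal
  normal of \<open>\<beta>\<close> (\<open>orthogonal_if_dual_linearly_dependent\<close>), the second by the Frenet frame, the third
  because the Frenet formulas express \<open>N'\<close> through the tangent and the binormal.
  Hence \<open>l\<close> has derivative zero, and since any two parameters are joined by a piecewise \<open>C\<^sup>1\<close> path in the parameter domain, \<open>l\<close> is a constant \<open>c\<close>
  (\<open>zero_derivative_constant_on_dual_interval\<close>). The distance is the square root of \<open>c\<^sup>2\<close>. This covers
  the case in which \<open>c\<close> is a zero divisor.
\<close>

lemma dual_inner_eq_sum: "dual_inner v w = (\<Sum>i\<in>UNIV. v $ i * w $ i)"
  by (simp add: dual_number_eq_iff dual_inner_def re_vec_def du_vec_def inner_vec_def sum_3)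

lemma dual_inner_simps:
  "dual_inner (u + v) w = dual_inner u w + dual_inner v w"
  "dual_inner (u - v) w = dual_inner u w - dual_inner v w"
  "dual_inner (- v) w = - dual_inner v w"
  "dual_inner (c *s v) w = c * dual_inner v w"
  "dual_inner u (v + w) = dual_inner u v + dual_inner u w"
  "dual_inner u (v - w) = dual_inner u v - dual_inner u w"
  "dual_inner u (- w) = - dual_inner u w"
  "dual_inner v (c *s w) = c * dual_inner v w"
  "dual_inner 0 w = 0"
  by (simp_all add: dual_inner_eq_sum sum_3 algebra_simps)

lemma dual_inner_commute: "dual_inner v w = dual_inner w v"
  by (simp add: dual_inner_eq_sum mult.commute)

lemma dual_inner_cross_right: "dual_inner w (dual_cross v w) = 0"
  by (simp add: dual_inner_eq_sum dual_cross_def sum_3 algebra_simps)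

lemma has_derivative_dual_inner:
  assumes "(f has_derivative f') (at x within S)" and "(g has_derivative g') (at x within S)"
  shows "((\<lambda>x. dual_inner (f x) (g x)) has_derivative
    (\<lambda>h. dual_inner (f' h) (g x) + dual_inner (f x) (g' h))) (at x within S)"
proof -
  have "((\<lambda>x. f x $ i * g x $ i) has_derivative (\<lambda>h. f x $ i * g' h $ i + f' h $ i * g x $ i))
      (at x within S)" for i
    by (intro has_derivative_mult bounded_linear.has_derivative[OF bounded_linear_vec_nth] assms)
  then have "((\<lambda>x. \<Sum>i\<in>UNIV. f x $ i * g x $ i) has_derivative
      (\<lambda>h. \<Sum>i\<in>UNIV. f x $ i * g' h $ i + f' h $ i * g x $ i)) (at x within S)"
    by (intro has_derivative_sum)
  then show ?thesis
    by (simp add: dual_inner_eq_sum sum.distrib add.commute)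
qed

lemma bounded_linear_re_part: "bounded_linear re_part"
  by (rule bounded_linear_intro[where K = 1])
    (simp_all add: scaleR_dual_number_def norm_dual_number_def)

lemma bounded_linear_du_part: "bounded_linear du_part"
  by (rule bounded_linear_intro[where K = 1])
    (simp_all add: scaleR_dual_number_def norm_dual_number_def)

lemma zero_derivative_constant_along_valid_path:
  fixes f :: "'a::real_normed_vector \<Rightarrow> 'b::banach"
  assumes f: "\<And>x. x \<in> S \<Longrightarrow> (f has_derivative (\<lambda>h. 0)) (at x within S)"
    and \<gamma>: "valid_path \<gamma>" "path_image \<gamma> \<subseteq> S"
  shows "f (pathfinish \<gamma>) = f (pathstart \<gamma>)"
proof -
  from \<gamma>(1) obtain K where K: "finite K" "\<gamma> C1_differentiable_on ({0..1} - K)"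
    and \<gamma>_cont: "continuous_on {0..1} \<gamma>"
    by (auto simp: valid_path_def piecewise_C1_differentiable_on_def)
  from \<gamma>(2) have \<gamma>_in: "\<gamma> ` {0..1} \<subseteq> S"
    by (simp add: path_image_def)
  have "continuous_on S f"
    using f has_derivative_continuous continuous_on_eq_continuous_within by blast
  then have cont: "continuous_on {0..1} (\<lambda>t. f (\<gamma> t))"
    using \<gamma>_cont \<gamma>_in by (rule continuous_on_compose2)
  have deriv: "((\<lambda>t. f (\<gamma> t)) has_derivative (\<lambda>h. 0)) (at t within {0..1})"
    if t: "t \<in> {0..1} - K" for t
  proof -
    from K(2) t obtain v where "(\<gamma> has_vector_derivative v) (at t)"
      unfolding C1_differentiable_on_def by blast
    then have "(\<gamma> has_derivative (\<lambda>h. h *\<^sub>R v)) (at t within {0..1})"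
      by (simp add: has_vector_derivative_def has_derivative_at_withinI)
    then show ?thesis
      using t by (intro has_derivative_in_compose2[OF f \<gamma>_in]) auto
  qed
  show ?thesis
    using has_derivative_zero_unique_strong_interval[OF K(1) cont refl deriv, of 1]
    by (simp add: pathfinish_def pathstart_def)
qed

text \<open>
  The parameter domain may have empty interior, so the
  mean value theorem is applied along paths in it, to the real and the dual component in turn.
\<close>

lemma zero_derivative_constant_on_dual_interval:
  assumes I: "dual_interval I"
    and f: "\<And>s. s \<in> I \<Longrightarrow> has_dual_derivative f 0 s I"
  shows "f constant_on I"
proof -
  have re: "((\<lambda>s. re_part (f s)) has_derivative (\<lambda>h. 0)) (at s within I)"
    and du: "((\<lambda>s. du_part (f s)) has_derivative (\<lambda>h. 0)) (at s within I)" if "s \<in> I" for s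
    using bounded_linear.has_derivative[OF bounded_linear_re_part, of f "\<lambda>h. 0" "at s within I"]
      bounded_linear.has_derivative[OF bounded_linear_du_part, of f "\<lambda>h. 0" "at s within I"]
      f[OF that]
    by (simp_all add: has_dual_derivative_def)
  have "f s = f t" if st: "s \<in> I" "t \<in> I" for s t
  proof -
    from I st obtain \<gamma> where \<gamma>: "valid_path \<gamma>" "path_image \<gamma> \<subseteq> I" "pathstart \<gamma> = t" "pathfinish \<gamma> = s"
      unfolding dual_interval_def by blast
    show ?thesis
      using zero_derivative_constant_along_valid_path[OF re \<gamma>(1,2)]
        zero_derivative_constant_along_valid_path[OF du \<gamma>(1,2)] \<gamma>(3,4)
      by (simp add: dual_number_eq_iff)
  qed
  then show ?thesis
    unfolding constant_on_def by blast
qed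

lemma dual_mult_eq_0_cancel:
  assumes "a * x = 0" and "\<not> pure_dual a"
  shows "x = 0"
  using assms by (auto simp: dual_number_eq_iff pure_dual_def)

text \<open>
  In a relation \<open>a *s v + b *s w = 0\<close> with \<open>w\<close> a unit vector, taking the inner product with \<open>w\<close> writes
  \<open>b\<close> as a multiple of \<open>a\<close>. So \<open>a\<close> cannot be a zero divisor without \<open>b\<close> being one too, and
  \<open>v\<close> is a multiple of \<open>w\<close>. This is the point where dependence over a ring with zero divisors
  behaves as over a field.
\<close>

lemma orthogonal_if_dual_linearly_dependent:
  assumes dep: "dual_linearly_dependent v w"
    and unit: "dual_inner w w = 1"
    and orth: "dual_inner u w = 0"
  shows "dual_inner u v = 0"
proof -
  from dep obtain a b where ab: "\<not> (pure_dual a \<and> pure_dual b)" and rel: "a *s v + b *s w = 0"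
    unfolding dual_linearly_dependent_def by blast
  have inner_rel: "a * dual_inner v x + b * dual_inner w x = 0" for x
    using arg_cong[OF rel, of "\<lambda>y. dual_inner y x"] by (simp add: dual_inner_simps)
  have "b = - (a * dual_inner v w)"
    using inner_rel[of w] by (simp add: unit add_eq_0_iff)
  then have "\<not> pure_dual a"
    using ab by (auto simp: pure_dual_def)
  moreover have "a * dual_inner u v = 0"
    using inner_rel[of u] orth by (simp add: dual_inner_commute)
  ultimately show ?thesis
    by (rule dual_mult_eq_0_cancel[rotated])
qed

theorem theorem1:
  fixes I J :: "dual_number set"
    and \<alpha> T\<^sub>\<alpha> N\<^sub>\<alpha> B\<^sub>\<alpha> \<beta> T\<^sub>\<beta> N\<^sub>\<beta> B\<^sub>\<beta> :: "dual_number \<Rightarrow> dual_vector"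
    and \<kappa>\<^sub>\<alpha> \<tau>\<^sub>\<alpha> \<kappa>\<^sub>\<beta> \<tau>\<^sub>\<beta> :: "dual_number \<Rightarrow> dual_number"
    and \<phi> :: "dual_number \<Rightarrow> dual_number"
  assumes "dual_frenet_curve I \<alpha> T\<^sub>\<alpha> N\<^sub>\<alpha> B\<^sub>\<alpha> \<kappa>\<^sub>\<alpha> \<tau>\<^sub>\<alpha>"
    and "dual_frenet_curve J \<beta> T\<^sub>\<beta> N\<^sub>\<beta> B\<^sub>\<beta> \<kappa>\<^sub>\<beta> \<tau>\<^sub>\<beta>"
    and "bertrand_correspondence I \<alpha> N\<^sub>\<alpha> J \<beta> N\<^sub>\<beta> \<phi>"
  shows "\<exists>c :: dual_number. \<forall>s\<in>I. dual_dist (\<alpha> s) (\<beta> (\<phi> s)) = c"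
proof -
  define l where "l s = dual_inner (\<beta> (\<phi> s) - \<alpha> s) (N\<^sub>\<alpha> s)" for s
  have I: "dual_interval I" and J: "\<phi> ` I = J"
    using assms by (auto simp: dual_frenet_curve_def bertrand_correspondence_def)
  have offset: "\<beta> (\<phi> s) - \<alpha> s = l s *s N\<^sub>\<alpha> s" and unit: "dual_inner (N\<^sub>\<alpha> s) (N\<^sub>\<alpha> s) = 1" if s: "s \<in> I" for s
  proof -
    show unit: "dual_inner (N\<^sub>\<alpha> s) (N\<^sub>\<alpha> s) = 1"
      using assms(1) s by (simp add: dual_frenet_curve_def)
    obtain k where "\<beta> (\<phi> s) = \<alpha> s + k *s N\<^sub>\<alpha> s"
      using assms(3) s by (auto simp: bertrand_correspondence_def)
    then show "\<beta> (\<phi> s) - \<alpha> s = l s *s N\<^sub>\<alpha> s"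
      by (simp add: l_def dual_inner_simps unit)
  qed
  have "has_dual_derivative l 0 s I" if s: "s \<in> I" for s
  proof -
    let ?N' = "- (\<kappa>\<^sub>\<alpha> s *s T\<^sub>\<alpha> s) + \<tau>\<^sub>\<alpha> s *s B\<^sub>\<alpha> s"
    from s J have \<phi>s: "\<phi> s \<in> J"
      by blast
    have frame: "dual_inner (T\<^sub>\<alpha> s) (N\<^sub>\<alpha> s) = 0" "B\<^sub>\<alpha> s = dual_cross (T\<^sub>\<alpha> s) (N\<^sub>\<alpha> s)"
      and \<alpha>': "(\<alpha> has_derivative (\<lambda>h. h *s T\<^sub>\<alpha> s)) (at s within I)"
      and N': "(N\<^sub>\<alpha> has_derivative (\<lambda>h. h *s ?N')) (at s within I)"
      using assms(1) s unfolding dual_frenet_curve_def has_dual_vector_derivative_def by blast+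
    have \<beta>': "(\<beta> has_derivative (\<lambda>h. h *s T\<^sub>\<beta> t)) (at t within J)" if "t \<in> J" for t
      using assms(2) that unfolding dual_frenet_curve_def has_dual_vector_derivative_def by blast
    obtain d where \<phi>': "(\<phi> has_derivative (\<lambda>h. h * d)) (at s within I)"
      and dep: "dual_linearly_dependent (N\<^sub>\<alpha> s) (N\<^sub>\<beta> (\<phi> s))"
      using assms(3) s by (auto simp: bertrand_correspondence_def has_dual_derivative_def)
    have "((\<lambda>s. \<beta> (\<phi> s)) has_derivative (\<lambda>h. (h * d) *s T\<^sub>\<beta> (\<phi> s))) (at s within I)"
      by (rule has_derivative_in_compose2[OF \<beta>' _ s \<phi>']) (use J in auto)
    then have deriv: "(l has_derivative (\<lambda>h. dual_inner ((h * d) *s T\<^sub>\<beta> (\<phi> s) - h *s T\<^sub>\<alpha> s) (N\<^sub>\<alpha> s)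
        + dual_inner (\<beta> (\<phi> s) - \<alpha> s) (h *s ?N'))) (at s within I)"
      unfolding l_def by (intro has_derivative_dual_inner has_derivative_diff \<alpha>' N')
    have "dual_inner (T\<^sub>\<beta> (\<phi> s)) (N\<^sub>\<alpha> s) = 0"
      using assms(2) \<phi>s
      by (intro orthogonal_if_dual_linearly_dependent[OF dep]) (simp_all add: dual_frenet_curve_def)
    moreover have "dual_inner (N\<^sub>\<alpha> s) (T\<^sub>\<alpha> s) = 0" "dual_inner (N\<^sub>\<alpha> s) (B\<^sub>\<alpha> s) = 0"
      using frame by (simp_all add: dual_inner_commute dual_inner_cross_right)
    ultimately have "dual_inner ((h * d) *s T\<^sub>\<beta> (\<phi> s) - h *s T\<^sub>\<alpha> s) (N\<^sub>\<alpha> s)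
        + dual_inner (\<beta> (\<phi> s) - \<alpha> s) (h *s ?N') = 0" for h
      using frame(1) by (simp add: offset[OF s] dual_inner_simps)
    then show ?thesis
      using deriv by (simp add: has_dual_derivative_def)
  qed
  with I have "l constant_on I"
    by (rule zero_derivative_constant_on_dual_interval)
  then obtain c where c: "l s = c" if "s \<in> I" for s
    by (auto simp: constant_on_def)
  have "dual_dist (\<alpha> s) (\<beta> (\<phi> s)) = dual_sqrt (c * c)" if "s \<in> I" for s
    using that by (simp add: dual_dist_def dual_norm_def offset unit c dual_inner_simps)
  then show ?thesis
    by blast
qed

end
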